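(* Let $R=\mathbb F_{q_1}\times\cdots\times\mathbb F_{q_t}$ be a product of $t\ge 5$ finite fields of orders $q_1,\dots,q_t$. Then $$\omega(\mathcal D(R))\ \ge\ \sum_{\substack{A\subseteq[t]\\ |A|=t-2}} w(A)\ +\ t,\qquad\text{where } w(A)=\prod_{i\in A}(q_i-1).$$
   Context: $[t]=\{1,\dots,t\}$. $Z(R)$ is the set of zero-divisors of $R$ and $Z(R)^*=Z(R)\setminus\{0\}$. $\Gamma(R)$ is the simple graph with vertex set $Z(R)^*$, with distinct $x,y$ adjacent iff $xy=0$. $W\Gamma(R)$ is the simple graph with vertex set $Z(R)^*$, with distinct $x,y$ adjacent iff there exist nonzero $r\in\operatorname{Ann}(x)$ and nonzero $s\in\operatorname{Ann}(y)$ with $rs=0$. The weak zero-divisor difference graph $\mathcal D(R)$ is the graph on $Z(R)^*$ with edge set $E(W\Gamma(R))\setminus E(\Gamma(R))$, with resulting isolated vertices deleted. $\omega(G)$ is the clique number of $G$. *)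

theory Defs
  imports "HOL-Algebra.Algebra" "HOL-Library.Ramsey"
begin

text \<open>A simple graph is a pair (V, E) whose edges are two-element subsets of V, the edge
  representation used by \<^const>\<open>clique\<close>.\<close>

type_synonym 'a sgraph = "'a set \<times> 'a set set"

text \<open>Zero counts as a zero-divisor of every nonzero ring. The rings considered are
  commutative, so one-sided products suffice here and in \<open>annihilator\<close>.\<close>

definition zero_divisors :: "('a, 'm) ring_scheme \<Rightarrow> 'a set" where
  "zero_divisors R =
     {x \<in> carrier R. \<exists>y \<in> carrier R. y \<noteq> \<zero>\<^bsub>R\<^esub> \<and> x \<otimes>\<^bsub>R\<^esub> y = \<zero>\<^bsub>R\<^esub>}"

definition nonzero_zero_divisors :: "('a, 'm) ring_scheme \<Rightarrow> 'a set" where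
  "nonzero_zero_divisors R = zero_divisors R - {\<zero>\<^bsub>R\<^esub>}"

definition annihilator :: "('a, 'm) ring_scheme \<Rightarrow> 'a \<Rightarrow> 'a set" where
  "annihilator R x = {r \<in> carrier R. r \<otimes>\<^bsub>R\<^esub> x = \<zero>\<^bsub>R\<^esub>}"

definition zero_divisor_graph :: "('a, 'm) ring_scheme \<Rightarrow> 'a sgraph" where
  "zero_divisor_graph R =
     (nonzero_zero_divisors R,
      {{x, y} | x y. x \<in> nonzero_zero_divisors R \<and> y \<in> nonzero_zero_divisors R \<and> x \<noteq> y \<and>
         x \<otimes>\<^bsub>R\<^esub> y = \<zero>\<^bsub>R\<^esub>})"

definition weak_zero_divisor_graph :: "('a, 'm) ring_scheme \<Rightarrow> 'a sgraph" where
  "weak_zero_divisor_graph R =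
     (nonzero_zero_divisors R,
      {{x, y} | x y. x \<in> nonzero_zero_divisors R \<and> y \<in> nonzero_zero_divisors R \<and> x \<noteq> y \<and>
         (\<exists>r \<in> annihilator R x - {\<zero>\<^bsub>R\<^esub>}. \<exists>s \<in> annihilator R y - {\<zero>\<^bsub>R\<^esub>}.
            r \<otimes>\<^bsub>R\<^esub> s = \<zero>\<^bsub>R\<^esub>)})"

definition delete_isolated :: "'a sgraph \<Rightarrow> 'a sgraph" where
  "delete_isolated G = ({v \<in> fst G. \<exists>e \<in> snd G. v \<in> e}, snd G)"

definition difference_graph :: "('a, 'm) ring_scheme \<Rightarrow> 'a sgraph" where
  "difference_graph R =
     delete_isolated
       (nonzero_zero_divisors R,
        snd (weak_zero_divisor_graph R) - snd (zero_divisor_graph R))"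

text \<open>Meaningful for graphs with finitely many vertices only: otherwise the maximum need not
  exist, and \<^const>\<open>card\<close> is 0 on infinite cliques.\<close>

definition clique_number :: "'a sgraph \<Rightarrow> nat" where
  "clique_number G = Max (card ` {K. K \<subseteq> fst G \<and> clique K (snd G)})"

end

theory Submission
  imports Defs
begin

text \<open>Writing elements of the product as functions on the index set $I$, two elements multiply to
  zero iff their supports are disjoint. If the supports of two nonzero zero-divisors meet, they are
  therefore adjacent in the difference graph as soon as there are distinct $i$ and $j$ outside the
  first and the second support respectively. Supports that omit at most two of at least five indices
  always meet, and suitable $i \neq j$ exist unless both supports omit exactly the same single index.
  Hence all elements with support of size $t-2$, together with one element of support
  $I \setminus \{i\}$ for each $i$, form a clique.\<close>

text \<open>In a clique with at least two vertices every vertex lies on an edge, so the whole clique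
  survives the deletion. Finiteness of \<open>V\<close> leaves finitely many cliques, so
  \<open>Max\<close> is a genuine upper bound.\<close>

lemma card_le_clique_number_delete_isolated:
  assumes "finite V" "K \<subseteq> V" "clique K E" "card K \<ge> 2"
  shows "card K \<le> clique_number (delete_isolated (V, E))"
proof -
  have "\<exists>e\<in>E. v \<in> e" if v: "v \<in> K" for v
  proof -
    have "K \<noteq> {v}" using assms(4) by auto
    then obtain w where "w \<in> K" "v \<noteq> w" using v by blast
    then have "{v, w} \<in> E" using assms(3) v by (auto simp: clique_def)
    then show ?thesis by blast
  qed
  then have K: "K \<subseteq> fst (delete_isolated (V, E))"
    using assms(2) by (auto simp: delete_isolated_def)
  have "finite (fst (delete_isolated (V, E)))"
    using assms(1) by (auto simp: delete_isolated_def)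
  then have "finite {K. K \<subseteq> fst (delete_isolated (V, E)) \<and> clique K (snd (delete_isolated (V, E)))}"
    by (rule finite_subset[rotated, OF finite_Pow_iff[THEN iffD2]]) auto
  then show ?thesis
    unfolding clique_number_def
    using K assms(3) by (intro Max_ge finite_imageI imageI) (auto simp: delete_isolated_def)
qed

text \<open>Trades lists for extensional functions on the index set, for which supports and
  cardinalities are easy to handle. Distinctness lets every list arise from a function: no index has
  to carry two entries.\<close>

lemma carrier_RDirProd_list_map:
  assumes "distinct xs"
  shows "carrier (RDirProd_list (map F xs))
           = (\<lambda>f. map f xs) ` (\<Pi>\<^sub>E i\<in>set xs. carrier (F i))"
proof (intro equalityI subsetI)
  fix as assume as: "as \<in> carrier (RDirProd_list (map F xs))"
  have len: "length as = length xs"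
    and nth: "\<And>k. k < length xs \<Longrightarrow> as ! k \<in> carrier (F (xs ! k))"
    using RDirProd_list_carrier_mem[OF as] by auto
  define f where "f = restrict (\<lambda>i. the (map_of (zip xs as) i)) (set xs)"
  have f: "f (xs ! k) = as ! k" if "k < length xs" for k
    using that assms len by (simp add: f_def map_of_zip_nth)
  have "f \<in> (\<Pi>\<^sub>E i\<in>set xs. carrier (F i))"
  proof (rule PiE_I)
    fix i assume "i \<in> set xs"
    then show "f i \<in> carrier (F i)" using f nth by (metis in_set_conv_nth)
  qed (simp add: f_def)
  moreover have "as = map f xs" using f len by (simp add: list_eq_iff_nth_eq)
  ultimately show "as \<in> (\<lambda>f. map f xs) ` (\<Pi>\<^sub>E i\<in>set xs. carrier (F i))" by blast
qed (auto intro!: RDirProd_list_carrier_memI simp: PiE_mem)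

lemma mult_RDirProd_list_map:
  assumes "f \<in> (\<Pi> i\<in>set xs. carrier (F i))" "g \<in> (\<Pi> i\<in>set xs. carrier (F i))"
  shows "map f xs \<otimes>\<^bsub>RDirProd_list (map F xs)\<^esub> map g xs = map (\<lambda>i. f i \<otimes>\<^bsub>F i\<^esub> g i) xs"
  using assms
proof (induction xs)
  case Nil
  then show ?case by (simp add: monoid.defs)
next
  case (Cons x xs)
  let ?S = "RDirProd_list (map F xs)"
  have "map h xs \<in> carrier ?S" if "h \<in> (\<Pi> i\<in>set (x # xs). carrier (F i))" for h
    using that by (intro RDirProd_list_carrier_memI) auto
  then have "(f x, map f xs) \<in> carrier (RDirProd (F x) ?S)"
    "(g x, map g xs) \<in> carrier (RDirProd (F x) ?S)"
    using Cons.prems by (auto simp: RDirProd_carrier)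
  \<comment> \<open>Prepending the head is a ring homomorphism from the binary product of
    \<open>F x\<close> and \<open>?S\<close>, so heads and tails multiply separately; the tails are
    the induction hypothesis.\<close>
  from ring_hom_mult[OF RDirProd_list_hom1 this] show ?case
    using Cons by (simp add: RDirProd_def DirProd_def monoid.defs)
qed

lemma zero_RDirProd_list_map:
  "\<zero>\<^bsub>RDirProd_list (map F xs)\<^esub> = map (\<lambda>i. \<zero>\<^bsub>F i\<^esub>) xs"
  by (induction xs) (auto simp: RDirProd_list_zero' monoid.defs)

locale field_product =
  fixes F :: "'i \<Rightarrow> ('a, 'm) ring_scheme" and xs :: "'i list"
  assumes distinct: "distinct xs"
    and field: "\<And>i. i \<in> set xs \<Longrightarrow> field (F i)"
    and finite_carrier: "\<And>i. i \<in> set xs \<Longrightarrow> finite (carrier (F i))"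
begin

abbreviation I where "I \<equiv> set xs"
abbreviation R where "R \<equiv> RDirProd_list (map F xs)"
abbreviation vec where "vec f \<equiv> map f xs"
abbreviation elts where "elts \<equiv> \<Pi>\<^sub>E i\<in>I. carrier (F i)"

definition supp :: "('i \<Rightarrow> 'a) \<Rightarrow> 'i set" where
  "supp f = {i \<in> I. f i \<noteq> \<zero>\<^bsub>F i\<^esub>}"

text \<open>The idempotent of the product with support \<open>A\<close>. Singletons give
  annihilating elements; complements of singletons give the \<open>card I\<close> extra clique
  members.\<close>

definition ind :: "'i set \<Rightarrow> 'i \<Rightarrow> 'a" where
  "ind A = (\<lambda>i\<in>I. if i \<in> A then \<one>\<^bsub>F i\<^esub> else \<zero>\<^bsub>F i\<^esub>)"

lemma supp_subset: "supp f \<subseteq> I"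
  by (auto simp: supp_def)

lemma finite_supp: "finite (supp f)"
  using supp_subset finite_subset by blast

lemma ind_in_elts: "ind A \<in> elts"
proof -
  have "\<one>\<^bsub>F i\<^esub> \<in> carrier (F i) \<and> \<zero>\<^bsub>F i\<^esub> \<in> carrier (F i)" if "i \<in> I" for i
  proof -
    interpret field "F i" using field[OF that] .
    show ?thesis by simp
  qed
  then show ?thesis by (auto simp: ind_def)
qed

lemma supp_ind: "A \<subseteq> I \<Longrightarrow> supp (ind A) = A"
  using domain.one_not_zero[OF field.axioms(1)[OF field]] by (auto simp: supp_def ind_def)

lemma inj_on_vec: "inj_on (\<lambda>f. vec f) elts"
  by (rule inj_onI) (auto intro: PiE_ext)

lemma vec_eq_zero_iff: "vec f = \<zero>\<^bsub>R\<^esub> \<longleftrightarrow> supp f = {}"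
  by (auto simp: zero_RDirProd_list_map supp_def)

text \<open>Multiplication is coordinatewise and each factor is a domain, so the product is nonzero
  exactly at the coordinates in both supports.\<close>

lemma mult_vec_eq_zero_iff:
  assumes "f \<in> elts" "g \<in> elts"
  shows "vec f \<otimes>\<^bsub>R\<^esub> vec g = \<zero>\<^bsub>R\<^esub> \<longleftrightarrow> supp f \<inter> supp g = {}"
proof -
  have "f i \<otimes>\<^bsub>F i\<^esub> g i = \<zero>\<^bsub>F i\<^esub> \<longleftrightarrow> f i = \<zero>\<^bsub>F i\<^esub> \<or> g i = \<zero>\<^bsub>F i\<^esub>" if i: "i \<in> I" for i
  proof -
    interpret field "F i" using field[OF i] .
    show ?thesis using assms i by (intro integral_iff) auto
  qed
  moreover have "vec f \<otimes>\<^bsub>R\<^esub> vec g = vec (\<lambda>i. f i \<otimes>\<^bsub>F i\<^esub> g i)"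
    using assms by (intro mult_RDirProd_list_map) auto
  ultimately show ?thesis by (auto simp: zero_RDirProd_list_map supp_def)
qed

lemma vec_in_carrier: "f \<in> elts \<Longrightarrow> vec f \<in> carrier R"
  unfolding carrier_RDirProd_list_map[OF distinct] by (rule imageI)

lemma vec_in_nonzero_zero_divisors:
  assumes "f \<in> elts" "supp f \<noteq> {}" "i \<in> I - supp f"
  shows "vec f \<in> nonzero_zero_divisors R"
  using assms vec_in_carrier[OF ind_in_elts[of "{i}"]] mult_vec_eq_zero_iff[OF _ ind_in_elts, of f "{i}"]
  by (auto simp: nonzero_zero_divisors_def zero_divisors_def vec_eq_zero_iff supp_ind vec_in_carrier
      intro!: bexI[of _ "vec (ind {i})"])

lemma vec_ind_in_annihilator:
  assumes "f \<in> elts" "i \<in> I - supp f"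
  shows "vec (ind {i}) \<in> annihilator R (vec f) - {\<zero>\<^bsub>R\<^esub>}"
  using assms vec_in_carrier[OF ind_in_elts[of "{i}"]] mult_vec_eq_zero_iff[OF ind_in_elts, of f "{i}"]
  by (auto simp: annihilator_def vec_eq_zero_iff supp_ind)

text \<open>The idempotents at \<open>i\<close> and \<open>j\<close> annihilate \<open>vec f\<close>
  and \<open>vec g\<close> respectively, and their product vanishes because \<open>i\<close> and
  \<open>j\<close> differ. This gives the weak edge; the common support coordinate rules out the
  ordinary one.\<close>

lemma difference_edge:
  assumes f: "f \<in> elts" and g: "g \<in> elts" and neq: "f \<noteq> g"
    and meet: "supp f \<inter> supp g \<noteq> {}"
    and i: "i \<in> I - supp f" and j: "j \<in> I - supp g" and ij: "i \<noteq> j"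
  shows "{vec f, vec g} \<in> snd (weak_zero_divisor_graph R) - snd (zero_divisor_graph R)"
proof
  have Z: "vec f \<in> nonzero_zero_divisors R" "vec g \<in> nonzero_zero_divisors R"
    using vec_in_nonzero_zero_divisors f g meet i j by blast+
  have "vec f \<noteq> vec g" using inj_on_vec f g neq by (auto dest: inj_onD)
  moreover have "vec (ind {i}) \<otimes>\<^bsub>R\<^esub> vec (ind {j}) = \<zero>\<^bsub>R\<^esub>"
    using i j ij by (simp add: mult_vec_eq_zero_iff ind_in_elts supp_ind)
  ultimately show "{vec f, vec g} \<in> snd (weak_zero_divisor_graph R)"
    unfolding weak_zero_divisor_graph_def
    using Z vec_ind_in_annihilator[OF f i] vec_ind_in_annihilator[OF g j] by fastforce
next
  \<comment> \<open>An edge is an unordered pair, so it could come from the graph's definition in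
    either order.\<close>
  have "vec f \<otimes>\<^bsub>R\<^esub> vec g \<noteq> \<zero>\<^bsub>R\<^esub>" "vec g \<otimes>\<^bsub>R\<^esub> vec f \<noteq> \<zero>\<^bsub>R\<^esub>"
    using f g meet by (auto simp: mult_vec_eq_zero_iff)
  then show "{vec f, vec g} \<notin> snd (zero_divisor_graph R)"
    by (auto simp: zero_divisor_graph_def doubleton_eq_iff simp del: map_eq_conv)
qed

lemma finite_elts: "finite elts"
  by (simp add: finite_PiE finite_carrier)

text \<open>Once the support is fixed, the coordinates vary independently: over the nonzero elements
  inside \<open>A\<close>, and over zero alone outside. The count is the weight w(A).\<close>

lemma card_elts_supp_eq:
  assumes "A \<subseteq> I"
  shows "card {f \<in> elts. supp f = A} = (\<Prod>i\<in>A. order (F i) - 1)"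
proof -
  have zero: "\<zero>\<^bsub>F i\<^esub> \<in> carrier (F i)" if "i \<in> I" for i
    using field[OF that] by (simp add: field_def domain_def cring_def ring.ring_simprules)
  have "{f \<in> elts. supp f = A}
      = (\<Pi>\<^sub>E i\<in>I. if i \<in> A then carrier (F i) - {\<zero>\<^bsub>F i\<^esub>} else {\<zero>\<^bsub>F i\<^esub>})" (is "_ = Pi\<^sub>E I ?C")
    using assms zero by (fastforce simp: supp_def PiE_iff split: if_splits)
  also have "card \<dots> = (\<Prod>i\<in>I. if i \<in> A then order (F i) - 1 else 1)"
    using zero finite_carrier
    by (subst card_PiE) (auto intro!: prod.cong simp: order_def card_Diff_singleton)
  also have "\<dots> = (\<Prod>i\<in>A. order (F i) - 1)"
    using assms by (simp add: prod.If_cases Int_absorb1)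
  finally show ?thesis .
qed

lemma card_elts_card_supp_eq:
  "card {f \<in> elts. card (supp f) = n}
     = (\<Sum>A\<in>{A. A \<subseteq> I \<and> card A = n}. \<Prod>i\<in>A. order (F i) - 1)"
proof -
  have "{f \<in> elts. card (supp f) = n} = (\<Union>A\<in>{A. A \<subseteq> I \<and> card A = n}. {f \<in> elts. supp f = A})"
    using supp_subset by auto
  also have "card \<dots> = (\<Sum>A\<in>{A. A \<subseteq> I \<and> card A = n}. card {f \<in> elts. supp f = A})"
    using finite_elts by (intro card_UN_disjoint) auto
  finally show ?thesis by (simp add: card_elts_supp_eq)
qed

lemma clique_number_difference_graph_ge:
  assumes large: "card I \<ge> 5"
  shows "clique_number (difference_graph R)
    \<ge> (\<Sum>A\<in>{A. A \<subseteq> I \<and> card A = card I - 2}. \<Prod>i\<in>A. order (F i) - 1) + card I"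
proof -
  \<comment> \<open>One element per index is all that fits: the annihilator of any element with
    support \<open>I - {i}\<close> is the copy of the field \<open>F i\<close>, so two such elements
    are never adjacent.\<close>
  define C where "C = (\<lambda>i. ind (I - {i})) ` I"
  define B where "B = {f \<in> elts. card (supp f) = card I - 2}"
  have supp_C: "supp (ind (I - {i})) = I - {i}" for i
    by (simp add: supp_ind)
  have "inj_on (\<lambda>i. ind (I - {i})) I"
  proof (rule inj_onI)
    fix i j assume "i \<in> I" "j \<in> I" and eq: "ind (I - {i}) = ind (I - {j})"
    have "I - {i} = I - {j}" using arg_cong[OF eq, of supp] unfolding supp_C .
    then have "i \<in> I - {j} \<longleftrightarrow> i \<in> I - {i}" by (simp only:)
    then show "i = j" using \<open>i \<in> I\<close> by simp
  qed
  then have card_C: "card C = card I" by (simp add: C_def card_image)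
  have BC_elts: "B \<union> C \<subseteq> elts" unfolding B_def C_def using ind_in_elts by blast
  have card_supp_C: "card (supp f) = card I - 1" if "f \<in> C" for f
    using that by (auto simp: C_def supp_C)
  have card_supp_B: "card (supp f) = card I - 2" if "f \<in> B" for f
    using that unfolding B_def by blast
  have card_supp: "card I - 2 \<le> card (supp f)" "card (supp f) < card I" if "f \<in> B \<union> C" for f
    using that large by (auto dest: card_supp_B card_supp_C)
  have ex_not_supp: "\<exists>i. i \<in> I - supp f" if "f \<in> B \<union> C" for f
  proof -
    have "supp f \<noteq> I" using card_supp(2)[OF that] by auto
    then show ?thesis using supp_subset[of f] by blast
  qed
  have edge: "{vec f, vec g} \<in> snd (weak_zero_divisor_graph R) - snd (zero_divisor_graph R)"
    if f: "f \<in> B \<union> C" and g: "g \<in> B \<union> C" and neq: "f \<noteq> g" for f g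
  proof -
    \<comment> \<open>Disjoint supports would force 2(t - 2) \<le> t for t = \<open>card I\<close>,
      that is t \<le> 4.\<close>
    have meet: "supp f \<inter> supp g \<noteq> {}"
    proof
      assume "supp f \<inter> supp g = {}"
      then have "card (supp f \<union> supp g) = card (supp f) + card (supp g)"
        by (simp add: card_Un_disjoint finite_supp)
      moreover have "card (supp f \<union> supp g) \<le> card I"
        by (intro card_mono) (simp_all add: supp_subset)
      ultimately show False using card_supp[OF f] card_supp[OF g] large by linarith
    qed
    obtain i j where i: "i \<in> I - supp f" and j: "j \<in> I - supp g"
      using ex_not_supp[OF f] ex_not_supp[OF g] by blast
    have "\<exists>i\<in>I - supp f. \<exists>j\<in>I - supp g. i \<noteq> j"
    proof (rule ccontr)
      assume "\<not> ?thesis"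
      then have eq: "k = l" if "k \<in> I - supp f" "l \<in> I - supp g" for k l
        using that by blast
      \<comment> \<open>Both complements are nonempty, and each element of one equals each element
        of the other, so both are the singleton \<open>{i}\<close>.\<close>
      have "k \<in> I - supp f \<longleftrightarrow> k = i" for k
        using i eq[OF _ j, of k] eq[OF i j] by (cases "k = i") auto
      moreover have "k \<in> I - supp g \<longleftrightarrow> k = i" for k
        using j eq[OF i, of k] eq[OF i j] by (cases "k = i") auto
      ultimately have single: "I - supp f = {i}" "I - supp g = {i}"
        by (simp_all add: set_eq_iff)
      \<comment> \<open>Members of \<open>B\<close> omit two indices, so \<open>h\<close> lies in
        \<open>C\<close>, where its support determines it. Hence \<open>f\<close> and
        \<open>g\<close> coincide, contrary to \<open>neq\<close>.\<close>
      have "h = ind (I - {i})" if h: "h \<in> B \<union> C" and s: "I - supp h = {i}" for h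
      proof -
        have "I - (I - supp h) = supp h" using supp_subset[of h] by (simp add: double_diff)
        then have eq: "supp h = I - {i}" unfolding s by (rule sym)
        moreover have "i \<in> I" using i by simp
        ultimately have "card (supp h) = card I - 1" by simp
        then have "card (supp h) \<noteq> card I - 2" using large by linarith
        then have "h \<in> C" using h card_supp_B[of h] by blast
        then obtain k where k: "k \<in> I" "h = ind (I - {k})" by (auto simp: C_def)
        have "I - {k} = I - {i}" using eq unfolding k(2) supp_C .
        with k(2) show ?thesis by (rule back_subst[of "\<lambda>S. h = ind S"])
      qed
      from this[OF f single(1)] this[OF g single(2)] neq show False by simp
    qed
    then obtain k l where "k \<in> I - supp f" "l \<in> I - supp g" "k \<noteq> l" by blast
    moreover have "f \<in> elts" "g \<in> elts" using f g BC_elts by blast+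
    ultimately show ?thesis using neq meet by (intro difference_edge)
  qed
  have finite_BC: "finite (B \<union> C)" using BC_elts finite_elts finite_subset by blast
  let ?K = "(\<lambda>f. vec f) ` (B \<union> C)"
  have "B \<inter> C = {}"
  proof (intro equals0I)
    fix f assume "f \<in> B \<inter> C"
    \<comment> \<open>With truncated subtraction this equation holds only for \<open>card I\<close>
      at most 1.\<close>
    then have "card I - 2 = card I - 1" using card_supp_B[of f] card_supp_C[of f] by simp
    then show False using large by linarith
  qed
  then have card_K: "card ?K = card B + card I"
    using inj_on_subset[OF inj_on_vec BC_elts] finite_BC
    by (simp add: card_image card_Un_disjoint card_C)
  have "card ?K \<le> clique_number (difference_graph R)"
    unfolding difference_graph_def
  proof (rule card_le_clique_number_delete_isolated)
    have "finite (carrier R)"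
      by (simp add: carrier_RDirProd_list_map[OF distinct] finite_elts)
    then show "finite (nonzero_zero_divisors R)"
      by (rule rev_finite_subset) (auto simp: nonzero_zero_divisors_def zero_divisors_def)
    show "clique ?K (snd (weak_zero_divisor_graph R) - snd (zero_divisor_graph R))"
      unfolding clique_def using edge by blast
    show "?K \<subseteq> nonzero_zero_divisors R"
    proof clarify
      fix f assume f: "f \<in> B \<union> C"
      have "supp f \<noteq> {}" using card_supp(1)[OF f] large by auto
      moreover have "f \<in> elts" using f BC_elts by blast
      moreover obtain i where "i \<in> I - supp f" using ex_not_supp[OF f] by blast
      ultimately show "vec f \<in> nonzero_zero_divisors R"
        using vec_in_nonzero_zero_divisors by simp
    qed
    show "2 \<le> card ?K" using card_K large by linarith
  qed
  then show ?thesis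
    using card_K by (simp add: B_def card_elts_card_supp_eq)
qed

end

theorem proposition6p5:
  fixes F :: "nat \<Rightarrow> ('a, 'm) ring_scheme"
    and q :: "nat \<Rightarrow> nat"
    and t :: nat
  assumes "t \<ge> 5"
    and "\<And>i. i \<in> {1..t} \<Longrightarrow> field (F i)"
    and "\<And>i. i \<in> {1..t} \<Longrightarrow> finite (carrier (F i))"
    and "\<And>i. i \<in> {1..t} \<Longrightarrow> order (F i) = q i"
  shows "clique_number (difference_graph (RDirProd_list (map F [1..<Suc t])))
           \<ge> (\<Sum>A \<in> {A. A \<subseteq> {1..t} \<and> card A = t - 2}. \<Prod>i\<in>A. (q i - 1)) + t"
proof -
  have set: "set [1..<Suc t] = {1..t}" by auto
  interpret field_product F "[1..<Suc t]"
    using assms(2,3) unfolding field_product_def set by auto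
  \<comment> \<open>The orders are known only for indices in \<open>{1..t}\<close>, so they are
    replaced under the restriction on \<open>A\<close>.\<close>
  have "(\<Prod>i\<in>A. order (F i) - 1) = (\<Prod>i\<in>A. q i - 1)" if "A \<subseteq> {1..t}" for A
    using that assms(4) by (intro prod.cong) auto
  then have "(\<Sum>A\<in>{A. A \<subseteq> {1..t} \<and> card A = t - 2}. \<Prod>i\<in>A. order (F i) - 1)
      = (\<Sum>A\<in>{A. A \<subseteq> {1..t} \<and> card A = t - 2}. \<Prod>i\<in>A. q i - 1)"
    by (intro sum.cong) auto
  then show ?thesis
    using clique_number_difference_graph_ge assms(1) unfolding set by simp
qed

end
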